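(* Let $G$ be a graph, $x\in V(G)$, and $N_G(x)=Y\cup Z$ any partition into two disjoint (possibly empty) sets. Then for every field $\Bbbk$, $\operatorname{reg}_{\Bbbk}(\mathcal{L}_x(G;Y,Z))=\operatorname{reg}_{\Bbbk}(G)+1$.
   Context: All graphs are finite and simple; $\operatorname{reg}_{\Bbbk}(G)=\max\{j\ge 0:\widetilde H_{j-1}(\operatorname{Ind}(G[S]);\Bbbk)\neq 0\text{ for some }S\subseteq V(G)\}$, where $\operatorname{Ind}$ denotes the independence complex and $\operatorname{Ind}$ of the empty graph is $\{\emptyset\}$ with $\widetilde H_{-1}=\Bbbk$. The Lozin transform $\mathcal{L}_x(G;Y,Z)$: delete $x$ and its incident edges, add four new vertices $y,a,b,z$ forming the path with edges $ya,ab,bz$, and join $y$ to every vertex of $Y$ and $z$ to every vertex of $Z$. (If $x$ is isolated, the result is $(G-x)$ plus a disjoint path on 4 vertices.) *)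

theory Defs
  imports Main
begin

definition simple_graph :: "'a set \<Rightarrow> 'a set set \<Rightarrow> bool" where
  "simple_graph V E \<longleftrightarrow> finite V \<and>
     (\<forall>e\<in>E. \<exists>u v. e = {u, v} \<and> u \<noteq> v \<and> u \<in> V \<and> v \<in> V)"

definition nbhd :: "'a set set \<Rightarrow> 'a \<Rightarrow> 'a set" where
  "nbhd E x = {v. {x, v} \<in> E}"

definition ind_complex :: "'a set set \<Rightarrow> 'a set \<Rightarrow> 'a set set" where
  "ind_complex E S = {I. I \<subseteq> S \<and> (\<forall>u\<in>I. \<forall>v\<in>I. u \<noteq> v \<longrightarrow> {u, v} \<notin> E)}"

(* Augmented simplicial chains, indexed by face cardinality n (dimension n-1),
   with values in a field 'k; orientation from the linear order on vertices. *)
definition chains :: "'a set set \<Rightarrow> nat \<Rightarrow> ('a set \<Rightarrow> 'k::field) set" where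
  "chains K n = {c. \<forall>\<sigma>. c \<sigma> \<noteq> 0 \<longrightarrow> \<sigma> \<in> K \<and> card \<sigma> = n}"

definition face_sign :: "'a::linorder set \<Rightarrow> 'a \<Rightarrow> 'k::field" where
  "face_sign \<sigma> v = (-1) ^ card {u\<in>\<sigma>. u < v}"

definition bd :: "'a::linorder set set \<Rightarrow> nat \<Rightarrow> ('a set \<Rightarrow> 'k::field) \<Rightarrow> ('a set \<Rightarrow> 'k)" where
  "bd K n c = (\<lambda>\<tau>. if \<tau> \<in> K \<and> card \<tau> = n then
      (\<Sum>\<sigma>\<in>{\<sigma>\<in>K. card \<sigma> = Suc n \<and> \<tau> \<subseteq> \<sigma>}. face_sign \<sigma> (the_elem (\<sigma> - \<tau>)) * c \<sigma>)
     else 0)"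

(* red_hom_nonzero TYPE('k) K n  <->  reduced homology H~_{n-1}(K; k) is nonzero *)
definition red_hom_nonzero :: "'k::field itself \<Rightarrow> 'a::linorder set set \<Rightarrow> nat \<Rightarrow> bool" where
  "red_hom_nonzero _ K n \<longleftrightarrow>
     (\<exists>c::'a set \<Rightarrow> 'k. c \<in> chains K n \<and> (case n of 0 \<Rightarrow> True | Suc m \<Rightarrow> (\<forall>\<tau>. bd K m c \<tau> = 0)) \<and>
        \<not> (\<exists>d \<in> chains K (Suc n). bd K n d = c))"

definition reg :: "'k::field itself \<Rightarrow> 'a::linorder set \<Rightarrow> 'a set set \<Rightarrow> nat" where
  "reg k V E = Max {j. \<exists>S\<subseteq>V. red_hom_nonzero k (ind_complex E S) j}"

definition lozin_V :: "'a set \<Rightarrow> 'a \<Rightarrow> 'a \<Rightarrow> 'a \<Rightarrow> 'a \<Rightarrow> 'a \<Rightarrow> 'a set" where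
  "lozin_V V x y a b z = (V - {x}) \<union> {y, a, b, z}"

definition lozin_E :: "'a set set \<Rightarrow> 'a \<Rightarrow> 'a set \<Rightarrow> 'a set \<Rightarrow> 'a \<Rightarrow> 'a \<Rightarrow> 'a \<Rightarrow> 'a \<Rightarrow> 'a set set" where
  "lozin_E E x Y Z y a b z = {e\<in>E. x \<notin> e} \<union> {{y, a}, {a, b}, {b, z}}
      \<union> {{y, v} | v. v \<in> Y} \<union> {{z, v} | v. v \<in> Z}"

end

theory Submission
  imports Defs "HOL-Library.Function_Algebras"
begin

text \<open>
  Put both graphs into one graph on V and the four new vertices, with x and its edges retained: G is
  then the subgraph induced on V, and its transform is the one obtained by deleting x. Wherever all
  faces of a complex K outside a subcomplex K' can be toggled at a fixed vertex w, K and K' have the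
  same homology. Three such vertex deletions (of x, and of y and z once x is back) show that the
  complex of a set W with y, a, b, z has the homology of the suspension of the complex of W with x,
  the suspension being the join with the edge ab.
  The remaining induced subgraphs of the transform miss one of y, a, b, z; for them leaves, twins
  (y against x after deleting Z) and the link-deletion sequence give the upper bound.
\<close>

section \<open>Annihilation and creation operators on chains\<close>

text \<open>
  The boundary operator is the sum of the operators \<^term>\<open>ann v\<close>. These and the operators
  \<^term>\<open>cre v\<close> satisfy the canonical anticommutation relations, so that no further bookkeeping of
  orientation signs is needed. The value 0 on infinite sets is a convention: there the signs, being
  defined through cardinalities, would break the relations.
\<close>

definition ann :: "'a::linorder \<Rightarrow> ('a set \<Rightarrow> 'k::field) \<Rightarrow> 'a set \<Rightarrow> 'k" where
  "ann v c \<tau> = (if finite \<tau> \<and> v \<notin> \<tau> then face_sign \<tau> v * c (insert v \<tau>) else 0)"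

definition cre :: "'a::linorder \<Rightarrow> ('a set \<Rightarrow> 'k::field) \<Rightarrow> 'a set \<Rightarrow> 'k" where
  "cre v c \<sigma> = (if finite \<sigma> \<and> v \<in> \<sigma> then face_sign \<sigma> v * c (\<sigma> - {v}) else 0)"

definition bdry :: "'a::linorder set \<Rightarrow> ('a set \<Rightarrow> 'k::field) \<Rightarrow> 'a set \<Rightarrow> 'k" where
  "bdry U c \<tau> = (\<Sum>v\<in>U. ann v c \<tau>)"

lemma face_sign_insert:
  assumes "finite \<tau>" and "w \<notin> \<tau>"
  shows "face_sign (insert w \<tau>) v = (if w < v then - face_sign \<tau> v else (face_sign \<tau> v :: 'k::field))"
proof (cases "w < v")
  case True
  then have "{u \<in> insert w \<tau>. u < v} = insert w {u \<in> \<tau>. u < v}" by auto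
  with True assms show ?thesis by (simp add: face_sign_def)
next
  case False
  then have "{u \<in> insert w \<tau>. u < v} = {u \<in> \<tau>. u < v}" by auto
  with False show ?thesis by (simp add: face_sign_def)
qed

lemma face_sign_square: "face_sign \<tau> v * (face_sign \<tau> v * c) = (c::'k::field)"
proof -
  have "face_sign \<tau> v * face_sign \<tau> v = (1::'k)"
    by (simp add: face_sign_def flip: power_add)
  then show ?thesis by (simp flip: mult.assoc)
qed

lemma ann_add: "ann v (c + d) = ann v c + ann v d"
  and ann_diff: "ann v (c - d) = ann v c - ann v d"
  and ann_zero: "ann v 0 = 0"
  and ann_uminus: "ann v (- c) = - ann v c"
  by (auto simp: ann_def fun_eq_iff algebra_simps)

lemma cre_add: "cre v (c + d) = cre v c + cre v d"
  and cre_zero: "cre v 0 = 0"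
  by (auto simp: cre_def fun_eq_iff algebra_simps)

lemma ann_anticommute: "ann v (ann w c) = - ann w (ann v c)"
proof
  fix \<tau>
  show "ann v (ann w c) \<tau> = (- ann w (ann v c)) \<tau>"
    by (cases v w rule: linorder_cases)
      (auto simp: ann_def face_sign_insert insert_commute)
qed

lemma ann_ann_self: "ann v (ann v c) = 0"
  by (auto simp: ann_def fun_eq_iff)

lemma ann_cre_anticommute:
  assumes "v \<noteq> w"
  shows "ann v (cre w c) = - cre w (ann v c)"
proof
  fix \<sigma>
  show "ann v (cre w c) \<sigma> = (- cre w (ann v c)) \<sigma>"
  proof (cases "finite \<sigma> \<and> v \<notin> \<sigma> \<and> w \<in> \<sigma>")
    case True
    then obtain \<rho> where r: "\<sigma> = insert w \<rho>" "w \<notin> \<rho>" by (meson mk_disjoint_insert)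
    with True assms have "insert v (insert w \<rho>) - {w} = insert v \<rho>" by auto
    with r True assms show ?thesis
      by (cases v w rule: linorder_cases)
        (auto simp: ann_def cre_def face_sign_insert insert_Diff_if)
  next
    case False
    with assms show ?thesis by (auto simp: ann_def cre_def)
  qed
qed

text \<open>At a finite set only one summand can be nonzero: the second if the set contains
  \<open>v\<close>, the first otherwise. Both vanish at infinite sets, hence the support
  condition.\<close>

lemma ann_cre_self:
  assumes "\<And>\<sigma>. c \<sigma> \<noteq> 0 \<Longrightarrow> finite \<sigma>"
  shows "ann v (cre v c) + cre v (ann v c) = c"
proof
  fix \<sigma>
  show "(ann v (cre v c) + cre v (ann v c)) \<sigma> = c \<sigma>"
  proof (cases "finite \<sigma>")
    case True
    show ?thesis
    proof (cases "v \<in> \<sigma>")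
      case True
      then obtain \<rho> where "\<sigma> = insert v \<rho>" "v \<notin> \<rho>" by (meson mk_disjoint_insert)
      with \<open>finite \<sigma>\<close> show ?thesis
        by (simp add: ann_def cre_def face_sign_insert face_sign_square)
    next
      case False
      with \<open>finite \<sigma>\<close> show ?thesis
        by (simp add: ann_def cre_def face_sign_insert face_sign_square)
    qed
  next
    case False
    with assms show ?thesis by (auto simp: ann_def cre_def)
  qed
qed

section \<open>Algebra of the total boundary operator\<close>

lemma bdry_empty: "bdry {} c = 0"
  by (auto simp: bdry_def)

lemma bdry_insert:
  assumes "finite U" and "v \<notin> U"
  shows "bdry (insert v U) c = ann v c + bdry U c"
  using assms by (auto simp: bdry_def)

lemma bdry_add: "bdry U (c + d) = bdry U c + bdry U d"
  and bdry_diff: "bdry U (c - d) = bdry U c - bdry U d"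
  and bdry_zero: "bdry U 0 = 0"
  and bdry_uminus: "bdry U (- c) = - bdry U c"
  by (auto simp: bdry_def ann_add ann_diff ann_zero ann_uminus sum.distrib sum_subtractf sum_negf)

lemma ann_bdry:
  assumes "finite U"
  shows "ann v (bdry U c) = - bdry U (ann v c)"
  using assms
proof (induction U)
  case empty
  \<comment> \<open>The goals are spelled out because \<open>?case\<close> is eta-expanded, which blocks rewriting of
    function equations.\<close>
  show "ann v (bdry {} c) = - bdry {} (ann v c)"
    by (simp add: bdry_empty ann_zero)
next
  case (insert w U)
  have IH: "ann v (bdry U c) = - bdry U (ann v c)" by (fact insert.IH)
  show "ann v (bdry (insert w U) c) = - bdry (insert w U) (ann v c)"
    using insert.hyps by (simp add: bdry_insert ann_add IH ann_anticommute[of v w])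
qed

lemma bdry_bdry:
  assumes "finite U"
  shows "bdry U (bdry U c) = 0"
  using assms
proof (induction U)
  case empty
  show "bdry {} (bdry {} c) = 0" by (rule bdry_empty)
next
  case (insert w U)
  have IH: "bdry U (bdry U c) = 0" by (fact insert.IH)
  show "bdry (insert w U) (bdry (insert w U) c) = 0"
    using insert.hyps by (simp add: bdry_insert ann_add bdry_add ann_ann_self ann_bdry IH)
qed

lemma bdry_cre_outside:
  assumes "finite U" and "v \<notin> U"
  shows "bdry U (cre v c) = - cre v (bdry U c)"
  using assms
proof (induction U)
  case empty
  show "bdry {} (cre v c) = - cre v (bdry {} c)"
    by (simp add: bdry_empty cre_zero)
next
  case (insert w U)
  then have IH: "bdry U (cre v c) = - cre v (bdry U c)" and "w \<noteq> v" by auto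
  show "bdry (insert w U) (cre v c) = - cre v (bdry (insert w U) c)"
    using insert.hyps \<open>w \<noteq> v\<close>
    by (simp add: bdry_insert cre_add IH ann_cre_anticommute)
qed

text \<open>Coning at \<open>v\<close> is a contracting homotopy: \<open>ann_cre_self\<close>
  handles the summand \<open>ann v\<close> of the boundary, and all other summands anticommute with
  \<open>cre v\<close>.\<close>

lemma bdry_cre:
  assumes "finite U" and "v \<in> U" and "\<And>\<sigma>. c \<sigma> \<noteq> 0 \<Longrightarrow> finite \<sigma>"
  shows "bdry U (cre v c) = c - cre v (bdry U c)"
proof -
  obtain W where W: "U = insert v W" "v \<notin> W" using assms(2) by (meson mk_disjoint_insert)
  with assms(1) have "finite W" by simp
  have "ann v (cre v c) = c - cre v (ann v c)"
    using ann_cre_self[of c v, OF assms(3)] by (simp add: eq_diff_eq)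
  moreover have "bdry W (cre v c) = - cre v (bdry W c)"
    using W \<open>finite W\<close> by (simp add: bdry_cre_outside)
  ultimately show ?thesis
    using W \<open>finite W\<close> by (simp add: bdry_insert cre_add)
qed

section \<open>Homology of simplicial complexes\<close>

definition complex_on :: "'a set \<Rightarrow> 'a set set \<Rightarrow> bool" where
  "complex_on U K \<longleftrightarrow> finite U \<and> K \<subseteq> Pow U \<and> (\<forall>\<sigma>\<in>K. \<forall>\<tau>\<subseteq>\<sigma>. \<tau> \<in> K)"

lemma complex_onD:
  assumes "complex_on U K"
  shows "finite U" and "\<sigma> \<in> K \<Longrightarrow> \<sigma> \<subseteq> U" and "\<sigma> \<in> K \<Longrightarrow> finite \<sigma>"
    and "\<sigma> \<in> K \<Longrightarrow> \<tau> \<subseteq> \<sigma> \<Longrightarrow> \<tau> \<in> K"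
  using assms by (auto simp: complex_on_def intro: finite_subset)

lemma chains_zero: "0 \<in> chains K n"
  and chains_add: "c \<in> chains K n \<Longrightarrow> d \<in> chains K n \<Longrightarrow> c + d \<in> chains K n"
  and chains_diff: "c \<in> chains K n \<Longrightarrow> d \<in> chains K n \<Longrightarrow> c - d \<in> chains K n"
  and chains_uminus: "c \<in> chains K n \<Longrightarrow> - c \<in> chains K n"
  unfolding chains_def by (auto, metis add_0, metis add_0, metis diff_self, metis diff_self)

lemma chains_mono: "c \<in> chains K n \<Longrightarrow> K \<subseteq> L \<Longrightarrow> c \<in> chains L n"
  unfolding chains_def by blast

lemma bdry_nonzeroD:
  assumes "bdry U c \<tau> \<noteq> 0"
  obtains v where "v \<in> U" "v \<notin> \<tau>" "finite \<tau>" "c (insert v \<tau>) \<noteq> 0"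
proof -
  from assms obtain v where "v \<in> U" "ann v c \<tau> \<noteq> 0"
    unfolding bdry_def by (meson sum.neutral)
  with that show ?thesis by (auto simp: ann_def split: if_splits)
qed

lemma bdry_support:
  assumes "complex_on U K" and "c \<in> chains K n" and "bdry U c \<tau> \<noteq> 0"
  shows "\<tau> \<in> K" and "Suc (card \<tau>) = n"
proof -
  obtain v where "v \<in> U" "v \<notin> \<tau>" "finite \<tau>" "c (insert v \<tau>) \<noteq> 0"
    using assms(3) by (rule bdry_nonzeroD)
  moreover from this assms(2) have "insert v \<tau> \<in> K" "card (insert v \<tau>) = n"
    by (auto simp: chains_def)
  ultimately show "\<tau> \<in> K" "Suc (card \<tau>) = n"
    using complex_onD(4)[OF assms(1)] by auto
qed

lemma bdry_chains:
  assumes "complex_on U K" and "c \<in> chains K (Suc n)"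
  shows "bdry U c \<in> chains K n"
  using bdry_support[OF assms] by (auto simp: chains_def)

lemma cre_nonzeroD:
  assumes "cre v c \<sigma> \<noteq> 0"
  shows "finite \<sigma>" "v \<in> \<sigma>" "c (\<sigma> - {v}) \<noteq> 0"
  using assms by (auto simp: cre_def split: if_splits)

text \<open>The faces one larger than \<tau> correspond to the vertices that extend \<tau> within
  \<open>K\<close>; the signs agree because a vertex is not smaller than itself.\<close>

lemma bd_eq_bdry:
  assumes K: "complex_on U K" and c: "c \<in> chains K (Suc n)"
  shows "bd K n c = bdry U c"
proof
  fix \<tau>
  show "bd K n c \<tau> = bdry U c \<tau>"
  proof (cases "\<tau> \<in> K \<and> card \<tau> = n")
    case False
    then show ?thesis
      using bdry_support[OF K c, of \<tau>] by (auto simp: bd_def)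
  next
    case True
    then have fin: "finite \<tau>" using complex_onD[OF K] by blast
    define R where "R = {v \<in> U - \<tau>. insert v \<tau> \<in> K}"
    have "(\<Sum>\<sigma>\<in>{\<sigma>\<in>K. card \<sigma> = Suc n \<and> \<tau> \<subseteq> \<sigma>}. face_sign \<sigma> (the_elem (\<sigma> - \<tau>)) * c \<sigma>)
        = (\<Sum>v\<in>R. ann v c \<tau>)"
    proof (rule sum.reindex_bij_witness[where j = "\<lambda>\<sigma>. the_elem (\<sigma> - \<tau>)" and i = "\<lambda>v. insert v \<tau>"])
      fix \<sigma> assume s: "\<sigma> \<in> {\<sigma>\<in>K. card \<sigma> = Suc n \<and> \<tau> \<subseteq> \<sigma>}"
      then have "card (\<sigma> - \<tau>) = 1"
        using True fin by (simp add: card_Diff_subset)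
      then obtain v where "\<sigma> - \<tau> = {v}" by (rule card_1_singletonE)
      with s have v: "\<sigma> = insert v \<tau>" "v \<notin> \<tau>" by auto
      then have "insert v \<tau> - \<tau> = {v}" by auto
      with v s fin complex_onD(2)[OF K]
      show "insert (the_elem (\<sigma> - \<tau>)) \<tau> = \<sigma>" "the_elem (\<sigma> - \<tau>) \<in> R"
        "ann (the_elem (\<sigma> - \<tau>)) c \<tau> = face_sign \<sigma> (the_elem (\<sigma> - \<tau>)) * c \<sigma>"
        by (auto simp: R_def ann_def face_sign_insert)
    next
      fix v assume "v \<in> R"
      then have "insert v \<tau> - \<tau> = {v}" by (auto simp: R_def)
      with \<open>v \<in> R\<close> True fin show "the_elem (insert v \<tau> - \<tau>) = v"
        "insert v \<tau> \<in> {\<sigma>\<in>K. card \<sigma> = Suc n \<and> \<tau> \<subseteq> \<sigma>}"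
        by (auto simp: R_def)
    qed
    \<comment> \<open>A vertex of \<open>U\<close> outside \<open>R\<close> contributes 0: it lies
      in \<tau>, or adding it leaves \<open>K\<close>, where \<open>c\<close> vanishes.\<close>
    also have "\<dots> = bdry U c \<tau>"
      unfolding bdry_def using complex_onD(1)[OF K] c
      by (intro sum.mono_neutral_left) (auto simp: R_def ann_def chains_def)
    finally show ?thesis using True by (simp add: bd_def)
  qed
qed

text \<open>The case distinction of the definition disappears: at \<open>n = 0\<close> the condition
  \<open>bdry U c = 0\<close> is automatic, since no face has cardinality -1.\<close>

lemma red_hom_nonzero_iff:
  assumes K: "complex_on U K"
  shows "red_hom_nonzero TYPE('k::field) K n \<longleftrightarrow>
    (\<exists>c::'a::linorder set \<Rightarrow> 'k. c \<in> chains K n \<and> bdry U c = 0 \<and>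
      (\<forall>d\<in>chains K (Suc n). bdry U d \<noteq> c))"
proof -
  have "(case n of 0 \<Rightarrow> True | Suc m \<Rightarrow> \<forall>\<tau>. bd K m c \<tau> = 0) \<longleftrightarrow> bdry U c = 0"
    if "c \<in> chains K n" for c :: "'a set \<Rightarrow> 'k"
  proof (cases n)
    case 0
    then show ?thesis using bdry_support(2)[OF K that] by (auto simp: fun_eq_iff)
  next
    case (Suc m)
    then show ?thesis using bd_eq_bdry[OF K, of c m] that by (auto simp: fun_eq_iff)
  qed
  moreover have "(\<exists>d\<in>chains K (Suc n). bd K n d = c) \<longleftrightarrow> (\<exists>d\<in>chains K (Suc n). bdry U d = c)"
    for c :: "'a set \<Rightarrow> 'k"
    by (rule bex_cong) (simp_all add: bd_eq_bdry[OF K])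
  ultimately show ?thesis
    unfolding red_hom_nonzero_def by meson
qed

lemma red_hom_nonzero_face:
  assumes "complex_on U K" and "red_hom_nonzero TYPE('k::field) K n"
  shows "\<exists>\<sigma>\<in>K. card \<sigma> = n"
proof -
  obtain c :: "'a set \<Rightarrow> 'k" where c: "c \<in> chains K n" "\<forall>d\<in>chains K (Suc n). bdry U d \<noteq> c"
    using assms red_hom_nonzero_iff[OF assms(1)] by blast
  then have "c \<noteq> 0" using chains_zero bdry_zero by metis
  then obtain \<sigma> where "c \<sigma> \<noteq> 0" by (auto simp: fun_eq_iff)
  with c(1) show ?thesis by (auto simp: chains_def)
qed

text \<open>By \<open>toggle\<close>, the faces of \<open>K\<close> outside \<open>K'\<close> come
  in pairs differing by \<open>w\<close>, so chains modulo \<open>K'\<close> are contracted by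
  coning at \<open>w\<close>. The correction \<open>e\<close> is the cone over the part
  \<open>r\<close> of \<open>d\<close> outside \<open>K'\<close>.\<close>

lemma push_to_subcomplex:
  fixes d :: "'a::linorder set \<Rightarrow> 'k::field"
  assumes K: "complex_on U K" and K': "complex_on U K'" and "K' \<subseteq> K" and "w \<in> U"
    and toggle: "\<And>\<sigma>. \<sigma> \<in> K \<Longrightarrow> \<sigma> \<notin> K' \<Longrightarrow> insert w \<sigma> \<in> K \<and> \<sigma> - {w} \<notin> K'"
    and d: "d \<in> chains K n" and supp: "\<And>\<tau>. bdry U d \<tau> \<noteq> 0 \<Longrightarrow> \<tau> \<in> K'"
  shows "\<exists>e\<in>chains K (Suc n). d - bdry U e \<in> chains K' n"
proof
  define r where "r = (\<lambda>\<sigma>. if \<sigma> \<in> K' then 0 else d \<sigma>)"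
  have r: "r \<in> chains K n" and dr: "d - r \<in> chains K' n"
    using d by (auto simp: r_def chains_def)
  show e: "cre w r \<in> chains K (Suc n)"
    unfolding chains_def
  proof (intro CollectI allI impI)
    fix \<sigma> assume "cre w r \<sigma> \<noteq> 0"
    then have *: "finite \<sigma>" "w \<in> \<sigma>" "r (\<sigma> - {w}) \<noteq> 0" by (rule cre_nonzeroD)+
    then have "\<sigma> - {w} \<in> K" "\<sigma> - {w} \<notin> K'" "card (\<sigma> - {w}) = n"
      using d by (auto simp: r_def chains_def split: if_splits)
    with toggle[of "\<sigma> - {w}"] * show "\<sigma> \<in> K \<and> card \<sigma> = Suc n"
      by (metis card.remove insert_Diff)
  qed
  have eq: "d - bdry U (cre w r) = (d - r) + cre w (bdry U r)"
  proof -
    have "bdry U (cre w r) = r - cre w (bdry U r)"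
      using r \<open>w \<in> U\<close> complex_onD[OF K]
      by (intro bdry_cre) (auto simp: chains_def)
    then show ?thesis by simp
  qed
  \<comment> \<open>Outside \<open>K'\<close> only \<open>cre w (bdry U r)\<close> could survive.
    But \<open>bdry U r\<close> is the difference of two chains supported in \<open>K'\<close>, and
    removing \<open>w\<close> from \<sigma> does not lead into \<open>K'\<close>.\<close>
  have "\<sigma> \<in> K'" if nz: "(d - bdry U (cre w r)) \<sigma> \<noteq> 0" for \<sigma>
  proof (rule ccontr)
    assume "\<sigma> \<notin> K'"
    moreover from this dr have "(d - r) \<sigma> = 0" by (auto simp: chains_def)
    ultimately have "cre w (bdry U r) \<sigma> \<noteq> 0" using nz by (simp add: eq)
    then have *: "w \<in> \<sigma>" "bdry U r (\<sigma> - {w}) \<noteq> 0" by (rule cre_nonzeroD)+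
    have "\<sigma> \<in> K"
      using chains_diff[OF d bdry_chains[OF K e]] nz by (auto simp: chains_def)
    with toggle \<open>\<sigma> \<notin> K'\<close> have "\<sigma> - {w} \<notin> K'" by blast
    then have "bdry U d (\<sigma> - {w}) = 0" "bdry U (d - r) (\<sigma> - {w}) = 0"
      using supp bdry_support(1)[OF K' dr] by blast+
    with * show False by (simp add: bdry_diff)
  qed
  then show "d - bdry U (cre w r) \<in> chains K' n"
    using chains_diff[OF d bdry_chains[OF K e]] by (auto simp: chains_def)
qed

text \<open>Pushing is applied twice: to a cycle of \<open>K\<close>, giving a homologous cycle of
  \<open>K'\<close>, and to a chain of \<open>K\<close> that fills a cycle of \<open>K'\<close>,
  giving a filling inside \<open>K'\<close>.\<close>

lemma red_hom_nonzero_toggle: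
  assumes K: "complex_on U K" and K': "complex_on U K'" and sub: "K' \<subseteq> K" and w: "w \<in> U"
    and toggle: "\<And>\<sigma>. \<sigma> \<in> K \<Longrightarrow> \<sigma> \<notin> K' \<Longrightarrow> insert w \<sigma> \<in> K \<and> \<sigma> - {w} \<notin> K'"
  shows "red_hom_nonzero TYPE('k::field) K n \<longleftrightarrow> red_hom_nonzero TYPE('k) K' n"
proof
  have push: "\<exists>e\<in>chains K (Suc m). d - bdry U e \<in> chains K' m"
    if "d \<in> chains K m" and "\<And>\<tau>. bdry U d \<tau> \<noteq> 0 \<Longrightarrow> \<tau> \<in> K'" for d :: "'a set \<Rightarrow> 'k" and m
    using push_to_subcomplex[OF K K' sub w _ that] toggle by blast
  note fin = complex_onD(1)[OF K]
  {
    assume "red_hom_nonzero TYPE('k) K n"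
    then obtain c :: "'a set \<Rightarrow> 'k" where c: "c \<in> chains K n" "bdry U c = 0"
      "\<And>d. d \<in> chains K (Suc n) \<Longrightarrow> bdry U d \<noteq> c"
      using red_hom_nonzero_iff[OF K] by blast
    then obtain e where e: "e \<in> chains K (Suc n)" "c - bdry U e \<in> chains K' n"
      using push[of c n] by auto
    have "bdry U d \<noteq> c - bdry U e" if "d \<in> chains K' (Suc n)" for d
    proof
      assume "bdry U d = c - bdry U e"
      then have "bdry U (d + e) = c" by (simp add: bdry_add)
      with c(3) chains_add[OF chains_mono[OF that sub] e(1)] show False by blast
    qed
    with e c(2) fin show "red_hom_nonzero TYPE('k) K' n"
      by (subst red_hom_nonzero_iff[OF K'])
        (auto intro!: exI[of _ "c - bdry U e"] simp: bdry_diff bdry_bdry)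
  }
  {
    assume "red_hom_nonzero TYPE('k) K' n"
    then obtain c :: "'a set \<Rightarrow> 'k" where c: "c \<in> chains K' n" "bdry U c = 0"
      "\<And>d. d \<in> chains K' (Suc n) \<Longrightarrow> bdry U d \<noteq> c"
      using red_hom_nonzero_iff[OF K'] by blast
    have "bdry U d \<noteq> c" if d: "d \<in> chains K (Suc n)" for d
    proof
      assume eq: "bdry U d = c"
      then obtain e where "e \<in> chains K (Suc (Suc n))" "d - bdry U e \<in> chains K' (Suc n)"
        using push[OF d] c(1) by (auto simp: chains_def)
      moreover have "bdry U (d - bdry U e) = c" using eq fin by (simp add: bdry_diff bdry_bdry)
      ultimately show False using c(3) by blast
    qed
    with c chains_mono[OF c(1) sub] show "red_hom_nonzero TYPE('k) K n"
      by (subst red_hom_nonzero_iff[OF K]) blast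
  }
qed

section \<open>Deletion and link of a vertex\<close>

definition del :: "'a set set \<Rightarrow> 'a \<Rightarrow> 'a set set" where
  "del K v = {\<sigma>\<in>K. v \<notin> \<sigma>}"

definition lnk :: "'a set set \<Rightarrow> 'a \<Rightarrow> 'a set set" where
  "lnk K v = {\<sigma>. v \<notin> \<sigma> \<and> insert v \<sigma> \<in> K}"

lemma complex_on_del: "complex_on U K \<Longrightarrow> complex_on U (del K v)"
  by (auto simp: complex_on_def del_def)

lemma complex_on_lnk:
  assumes "complex_on U K" shows "complex_on U (lnk K v)"
  unfolding complex_on_def
proof (intro conjI ballI allI impI)
  fix \<sigma> \<tau> assume "\<sigma> \<in> lnk K v" "\<tau> \<subseteq> \<sigma>"
  then show "\<tau> \<in> lnk K v"
    using complex_onD(4)[OF assms, of "insert v \<sigma>" "insert v \<tau>"] by (auto simp: lnk_def)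
qed (use complex_onD[OF assms] in \<open>auto simp: lnk_def\<close>)

lemma lnk_subset_del: "complex_on U K \<Longrightarrow> lnk K v \<subseteq> del K v"
  by (auto simp: complex_on_def lnk_def del_def)

lemma ann_chains:
  assumes "complex_on U K" and "c \<in> chains K (Suc n)"
  shows "ann v c \<in> chains (lnk K v) n"
  using assms(2) by (auto simp: ann_def chains_def lnk_def split: if_splits)

lemma cre_chains:
  assumes "c \<in> chains (lnk K v) n"
  shows "cre v c \<in> chains K (Suc n)"
  unfolding chains_def
proof (intro CollectI allI impI)
  fix \<sigma> assume "cre v c \<sigma> \<noteq> 0"
  then have *: "finite \<sigma>" "v \<in> \<sigma>" "c (\<sigma> - {v}) \<noteq> 0" by (rule cre_nonzeroD)+
  then have "insert v (\<sigma> - {v}) \<in> K" "card (\<sigma> - {v}) = n"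
    using assms by (auto simp: chains_def lnk_def)
  with * show "\<sigma> \<in> K \<and> card \<sigma> = Suc n"
    by (metis card.remove insert_Diff)
qed

lemma ann_cre_lnk:
  assumes K: "complex_on U K" and c: "c \<in> chains (lnk K v) n"
  shows "ann v (cre v c) = c"
proof -
  have "ann v c = 0" using c by (auto simp: chains_def lnk_def ann_def fun_eq_iff)
  moreover have "ann v (cre v c) + cre v (ann v c) = c"
    using c complex_onD(3)[OF complex_on_lnk[OF K]]
    by (intro ann_cre_self) (auto simp: chains_def)
  ultimately show ?thesis by (simp add: cre_zero)
qed

text \<open>Up to sign, \<open>ann v\<close> reads off the coefficients on the faces through
  \<open>v\<close>.\<close>

lemma chains_del_iff:
  assumes "complex_on U K" and "c \<in> chains K n"
  shows "c \<in> chains (del K v) n \<longleftrightarrow> ann v c = 0"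
proof
  assume "c \<in> chains (del K v) n"
  then show "ann v c = 0" by (auto simp: chains_def del_def ann_def fun_eq_iff)
next
  assume z: "ann v c = 0"
  have "c \<sigma> = 0" if "v \<in> \<sigma>" for \<sigma>
  proof (rule ccontr)
    assume nz: "c \<sigma> \<noteq> 0"
    then have "finite \<sigma>" using assms complex_onD(3) by (fastforce simp: chains_def)
    moreover have "insert v (\<sigma> - {v}) = \<sigma>" using that by auto
    ultimately have "ann v c (\<sigma> - {v}) = face_sign (\<sigma> - {v}) v * c \<sigma>"
      by (simp add: ann_def)
    with z nz show False by (simp add: face_sign_def)
  qed
  with assms(2) show "c \<in> chains (del K v) n" by (auto simp: chains_def del_def)
qed

text \<open>Exactness of the link-deletion sequence at the homology of \<open>K\<close>. As indices
  are face cardinalities, the link term sits one lower.\<close>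

lemma red_hom_nonzero_del_or_lnk:
  assumes K: "complex_on U K" and v: "v \<in> U" and hom: "red_hom_nonzero TYPE('k::field) K n"
  shows "red_hom_nonzero TYPE('k) (del K v) n \<or>
    (\<exists>m. n = Suc m \<and> red_hom_nonzero TYPE('k) (lnk K v) m)"
proof (rule ccontr)
  assume "\<not> ?thesis"
  then have no_del: "\<not> red_hom_nonzero TYPE('k) (del K v) n"
    and no_lnk: "\<And>m. n = Suc m \<Longrightarrow> \<not> red_hom_nonzero TYPE('k) (lnk K v) m" by auto
  note D = complex_on_del[OF K, of v] and L = complex_on_lnk[OF K, of v]
  note fin = complex_onD(1)[OF K]
  obtain c :: "'a set \<Rightarrow> 'k" where c: "c \<in> chains K n" "bdry U c = 0"
    "\<And>d. d \<in> chains K (Suc n) \<Longrightarrow> bdry U d \<noteq> c"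
    using hom red_hom_nonzero_iff[OF K] by blast
  have "\<exists>e\<in>chains (lnk K v) n. bdry U e = ann v c"
  proof (cases n)
    case 0
    then have "ann v c = 0" using c(1)
      by (auto simp: chains_def ann_def fun_eq_iff)
    then show ?thesis using chains_zero bdry_zero by metis
  next
    case (Suc m)
    moreover have "bdry U (ann v c) = 0" using ann_bdry[OF fin, of v c] c(2) by (simp add: ann_zero)
    ultimately show ?thesis
      using no_lnk ann_chains[OF K] c(1) red_hom_nonzero_iff[OF L] by blast
  qed
  then obtain e where e: "e \<in> chains (lnk K v) n" "bdry U e = ann v c" by blast
  have he: "cre v e \<in> chains K (Suc n)" using e(1) by (rule cre_chains)
  have c': "c + bdry U (cre v e) \<in> chains K n"
    using c(1) bdry_chains[OF K he] by (rule chains_add)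
  \<comment> \<open>Since \<open>ann v\<close> anticommutes with the boundary, the left side is
    \<open>ann v c - bdry U e\<close>; the corrected cycle thus avoids \<open>v\<close>.\<close>
  have "ann v (c + bdry U (cre v e)) = 0"
    using e fin by (simp add: ann_add ann_bdry ann_cre_lnk[OF K e(1)])
  then have "c + bdry U (cre v e) \<in> chains (del K v) n" using chains_del_iff[OF K c'] by blast
  moreover have "bdry U (c + bdry U (cre v e)) = 0" using c(2) fin by (simp add: bdry_add bdry_bdry)
  ultimately obtain d where d: "d \<in> chains (del K v) (Suc n)" "bdry U d = c + bdry U (cre v e)"
    using no_del red_hom_nonzero_iff[OF D] by blast
  have "d - cre v e \<in> chains K (Suc n)"
    using d(1) he by (intro chains_diff) (auto elim: chains_mono simp: del_def)
  moreover have "bdry U (d - cre v e) = c" using d(2) by (simp add: bdry_diff)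
  ultimately show False using c(3) by blast
qed

text \<open>A cycle \<open>c\<close> of the link is filled twice, by its cone at \<open>v\<close>
  and by a chain \<open>f\<close> of the deletion. The difference of the fillings is a cycle, from
  which \<open>ann v\<close> recovers \<open>c\<close>; a filling of it would give one of
  \<open>c\<close> in the link.\<close>

lemma red_hom_nonzero_lnk_lift:
  assumes K: "complex_on U K" and v: "v \<in> U"
    and acyclic: "\<not> red_hom_nonzero TYPE('k::field) (del K v) n"
    and hom: "red_hom_nonzero TYPE('k) (lnk K v) n"
  shows "red_hom_nonzero TYPE('k) K (Suc n)"
proof -
  note D = complex_on_del[OF K, of v] and L = complex_on_lnk[OF K, of v]
  note fin = complex_onD(1)[OF K]
  obtain c :: "'a set \<Rightarrow> 'k" where c: "c \<in> chains (lnk K v) n" "bdry U c = 0"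
    "\<And>d. d \<in> chains (lnk K v) (Suc n) \<Longrightarrow> bdry U d \<noteq> c"
    using hom red_hom_nonzero_iff[OF L] by blast
  obtain f where f: "f \<in> chains (del K v) (Suc n)" "bdry U f = c"
    using acyclic c red_hom_nonzero_iff[OF D] chains_mono[OF c(1) lnk_subset_del[OF K]] by blast
  have fK: "f \<in> chains K (Suc n)" using f(1) by (auto elim: chains_mono simp: del_def)
  have "bdry U (cre v c) = c - cre v (bdry U c)"
    using c(1) v fin complex_onD(3)[OF L] by (intro bdry_cre) (auto simp: chains_def)
  then have cyc: "bdry U (cre v c - f) = 0" using c(2) f(2) by (simp add: bdry_diff cre_zero)
  have "bdry U d \<noteq> cre v c - f" if d: "d \<in> chains K (Suc (Suc n))" for d
  proof
    assume "bdry U d = cre v c - f"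
    then have "ann v (bdry U d) = ann v (cre v c) - ann v f" by (simp add: ann_diff)
    also have "\<dots> = c" using ann_cre_lnk[OF K c(1)] chains_del_iff[OF K fK] f(1) by simp
    finally have "bdry U (- ann v d) = c" using fin by (simp add: ann_bdry bdry_uminus)
    with c(3) chains_uminus[OF ann_chains[OF K d]] show False by blast
  qed
  with cyc chains_diff[OF cre_chains[OF c(1)] fK] show ?thesis
    by (subst red_hom_nonzero_iff[OF K]) blast
qed

section \<open>Independence complexes\<close>

abbreviation ind_hom :: "'k::field itself \<Rightarrow> 'a::linorder set set \<Rightarrow> 'a set \<Rightarrow> nat \<Rightarrow> bool" where
  "ind_hom k E S n \<equiv> red_hom_nonzero k (ind_complex E S) n"

lemma complex_on_ind:
  assumes "finite U" and "S \<subseteq> U"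
  shows "complex_on U (ind_complex E S)"
  using assms unfolding complex_on_def ind_complex_def by blast

lemma ind_complex_insert:
  assumes "\<sigma> \<in> ind_complex E S" and "w \<in> S" and "\<And>u. u \<in> \<sigma> \<Longrightarrow> {w, u} \<notin> E"
  shows "insert w \<sigma> \<in> ind_complex E S"
  using assms by (auto simp: ind_complex_def insert_commute)

lemma ind_complex_not_edge:
  assumes "\<sigma> \<in> ind_complex E S" and "\<And>v. {v} \<notin> E" and "u \<in> \<sigma>" and "v \<in> \<sigma>"
  shows "{u, v} \<notin> E"
  using assms by (cases "u = v") (auto simp: ind_complex_def)

lemma ind_complex_cong:
  assumes "\<And>u v. u \<in> S \<Longrightarrow> v \<in> S \<Longrightarrow> {u, v} \<in> E \<longleftrightarrow> {u, v} \<in> F"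
  shows "ind_complex E S = ind_complex F S"
  using assms unfolding ind_complex_def by blast

text \<open>Every face can be toggled at the isolated vertex \<open>w\<close>, so the complex
  compares with the void one, which has no homology even at index 0.\<close>

lemma ind_hom_cone:
  assumes "finite S" and "w \<in> S" and "\<And>u. u \<in> S \<Longrightarrow> {w, u} \<notin> E"
  shows "\<not> ind_hom TYPE('k::field) E S n"
proof -
  have "complex_on S {}" using assms(1) by (simp add: complex_on_def)
  moreover have "ind_hom TYPE('k) E S n \<longleftrightarrow> red_hom_nonzero TYPE('k) ({} :: 'a set set) n"
  proof (rule red_hom_nonzero_toggle[where w = w and U = S])
    show "complex_on S (ind_complex E S)" by (rule complex_on_ind) (use assms in auto)
    fix \<sigma> assume "\<sigma> \<in> ind_complex E S" "\<sigma> \<notin> {}"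
    then show "insert w \<sigma> \<in> ind_complex E S \<and> \<sigma> - {w} \<notin> {}"
      using assms ind_complex_insert[of \<sigma> E S w] by (auto simp: ind_complex_def)
  qed (use assms \<open>complex_on S {}\<close> in auto)
  ultimately show ?thesis using red_hom_nonzero_face by blast
qed

text \<open>
  Faces through v that meet B are toggled at w1, the others at w2.
\<close>

lemma ind_hom_remove:
  assumes fin: "finite S" and v: "v \<in> S" and w1: "w1 \<in> S - {v} - B" and w2: "w2 \<in> S - {v} - B"
    and loopless: "\<And>u. {u} \<notin> E"
    and n1: "\<And>u. u \<in> S \<Longrightarrow> {w1, u} \<in> E \<Longrightarrow> {v, u} \<in> E \<or> (\<forall>t\<in>B. {t, u} \<in> E)"
    and n2: "\<And>u. u \<in> S \<Longrightarrow> {w2, u} \<in> E \<Longrightarrow> {v, u} \<in> E \<or> u \<in> B"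
  shows "ind_hom TYPE('k::field) E S n \<longleftrightarrow> ind_hom TYPE('k) E (S - {v}) n"
proof -
  define K1 where "K1 = {\<sigma> \<in> ind_complex E S. v \<in> \<sigma> \<longrightarrow> \<sigma> \<inter> B = {}}"
  have K: "complex_on S (ind_complex E S)" by (rule complex_on_ind) (use fin in auto)
  then have K1: "complex_on S K1" unfolding K1_def complex_on_def by blast
  have K0: "complex_on S (ind_complex E (S - {v}))" by (rule complex_on_ind) (use fin in auto)
  have "ind_hom TYPE('k) E S n \<longleftrightarrow> red_hom_nonzero TYPE('k) K1 n"
  proof (rule red_hom_nonzero_toggle[OF K K1, of w1])
    fix \<sigma> assume s: "\<sigma> \<in> ind_complex E S" "\<sigma> \<notin> K1"
    then obtain t where t: "v \<in> \<sigma>" "t \<in> \<sigma>" "t \<in> B" by (auto simp: K1_def)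
    \<comment> \<open>A neighbour of \<open>w1\<close> in \<sigma> would be adjacent to
      \<open>v\<close> or to \<open>t\<close>, both members of the independent set \<sigma>.\<close>
    have "{w1, u} \<notin> E" if "u \<in> \<sigma>" for u
      using n1[of u] ind_complex_not_edge[OF s(1) loopless, of _ u] t that s(1)
      by (auto simp: ind_complex_def)
    then show "insert w1 \<sigma> \<in> ind_complex E S \<and> \<sigma> - {w1} \<notin> K1"
      using s(1) t w1 by (auto intro: ind_complex_insert simp: K1_def)
  qed (use w1 in \<open>auto simp: K1_def\<close>)
  also have "\<dots> \<longleftrightarrow> ind_hom TYPE('k) E (S - {v}) n"
  proof (rule red_hom_nonzero_toggle[OF K1 K0, of w2])
    fix \<sigma> assume s: "\<sigma> \<in> K1" "\<sigma> \<notin> ind_complex E (S - {v})"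
    then have s': "\<sigma> \<in> ind_complex E S" "v \<in> \<sigma>" "\<sigma> \<inter> B = {}"
      by (auto simp: K1_def ind_complex_def)
    have "{w2, u} \<notin> E" if "u \<in> \<sigma>" for u
      using n2[of u] ind_complex_not_edge[OF s'(1) loopless, of _ u] s' that
      by (auto simp: ind_complex_def)
    then have "insert w2 \<sigma> \<in> ind_complex E S" using w2 s'(1) by (auto intro: ind_complex_insert)
    then show "insert w2 \<sigma> \<in> K1 \<and> \<sigma> - {w2} \<notin> ind_complex E (S - {v})"
      using s' w2 by (auto simp: K1_def ind_complex_def)
  qed (use w2 in \<open>auto simp: K1_def ind_complex_def\<close>)
  finally show ?thesis .
qed

text \<open>With both vertices present, either one may be removed, since each has its neighbours
  among those of the other.\<close>

lemma ind_hom_twins: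
  assumes fin: "finite S" and "x \<notin> S" and "y \<notin> S" and "x \<noteq> y" and "{x, y} \<notin> E"
    and loopless: "\<And>u. {u} \<notin> E" and twins: "\<And>u. u \<in> S \<Longrightarrow> {x, u} \<in> E \<longleftrightarrow> {y, u} \<in> E"
  shows "ind_hom TYPE('k::field) E (insert x S) n \<longleftrightarrow> ind_hom TYPE('k) E (insert y S) n"
proof -
  let ?T = "insert x (insert y S)"
  have xy: "?T - {x} = insert y S" "?T - {y} = insert x S" using assms by auto
  have "{y, x} \<notin> E" using assms(5) by (simp add: insert_commute)
  have "ind_hom TYPE('k) E ?T n \<longleftrightarrow> ind_hom TYPE('k) E (?T - {x}) n"
  proof (rule ind_hom_remove[where B = "{}" and ?w1.0 = y and ?w2.0 = y])
    show "{x, u} \<in> E \<or> u \<in> {}" if "u \<in> ?T" "{y, u} \<in> E" for u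
      using that twins[of u] loopless[of y] \<open>{y, x} \<notin> E\<close> by auto
  qed (use assms in simp_all)
  moreover have "ind_hom TYPE('k) E ?T n \<longleftrightarrow> ind_hom TYPE('k) E (?T - {y}) n"
  proof (rule ind_hom_remove[where B = "{}" and ?w1.0 = x and ?w2.0 = x])
    show "{y, u} \<in> E \<or> u \<in> {}" if "u \<in> ?T" "{x, u} \<in> E" for u
      using that twins[of u] loopless[of x] \<open>{x, y} \<notin> E\<close> by auto
  qed (use assms in simp_all)
  ultimately show ?thesis by (simp add: xy)
qed

lemma del_ind_complex: "del (ind_complex E S) v = ind_complex E (S - {v})"
  by (auto simp: del_def ind_complex_def)

lemma lnk_ind_complex:
  assumes "v \<in> S"
  shows "lnk (ind_complex E S) v = ind_complex E (S - {v} - nbhd E v)"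
  using assms by (auto simp: lnk_def ind_complex_def nbhd_def insert_commute)

lemma ind_hom_delete_or_link:
  assumes "finite S" and "v \<in> S" and "ind_hom TYPE('k::field) E S n"
  shows "ind_hom TYPE('k) E (S - {v}) n \<or>
    (\<exists>m. n = Suc m \<and> ind_hom TYPE('k) E (S - {v} - nbhd E v) m)"
proof -
  have "complex_on S (ind_complex E S)" by (rule complex_on_ind) (use assms in auto)
  from red_hom_nonzero_del_or_lnk[OF this assms(2,3)] show ?thesis
    using assms(2) by (simp add: del_ind_complex lnk_ind_complex)
qed

text \<open>Deleting \<open>b\<close> isolates \<open>a\<close>, so the deletion is acyclic and all
  homology comes from the link of \<open>b\<close>, shifted by one.\<close>

lemma ind_hom_leaf:
  assumes fin: "finite S" and a: "a \<in> S" and b: "b \<in> S" and "a \<noteq> b"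
    and leaf: "\<And>u. u \<in> S \<Longrightarrow> {a, u} \<in> E \<Longrightarrow> u = b"
  shows "ind_hom TYPE('k::field) E S n \<longleftrightarrow>
    (\<exists>m. n = Suc m \<and> ind_hom TYPE('k) E (S - {b} - nbhd E b) m)"
proof -
  have K: "complex_on S (ind_complex E S)" by (rule complex_on_ind) (use fin in auto)
  have "\<not> ind_hom TYPE('k) E (S - {b}) m" for m
    by (rule ind_hom_cone[of _ a]) (use assms in auto)
  then show ?thesis
    using ind_hom_delete_or_link[OF fin b, where 'k = 'k, of E n]
      red_hom_nonzero_lnk_lift[OF K b, where 'k = 'k]
    by (auto simp: del_ind_complex lnk_ind_complex[OF b])
qed

section \<open>The Lozin transform\<close>

locale lozin_graph =
  fixes F :: "'a::linorder set set" and V :: "'a set" and x y a b z :: 'a and Y Z :: "'a set"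
  assumes fin: "finite V" and x: "x \<in> V" and dist: "distinct [y, a, b, z]"
    and new: "y \<notin> V" "a \<notin> V" "b \<notin> V" "z \<notin> V"
    and YV: "Y \<subseteq> V" and ZV: "Z \<subseteq> V"
    and loopless: "\<And>u. {u} \<notin> F"
    and nbhd_a: "nbhd F a = {y, b}" and nbhd_b: "nbhd F b = {a, z}"
    and nbhd_y: "nbhd F y = insert a Y" and nbhd_z: "nbhd F z = insert b Z"
    and nbhd_x: "nbhd F x = Y \<union> Z"
begin

lemma adj:
  "{a, u} \<in> F \<longleftrightarrow> u = y \<or> u = b" "{b, u} \<in> F \<longleftrightarrow> u = a \<or> u = z"
  "{y, u} \<in> F \<longleftrightarrow> u = a \<or> u \<in> Y" "{z, u} \<in> F \<longleftrightarrow> u = b \<or> u \<in> Z"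
  "{x, u} \<in> F \<longleftrightarrow> u \<in> Y \<or> u \<in> Z"
  using nbhd_a nbhd_b nbhd_y nbhd_z nbhd_x by (auto simp: nbhd_def set_eq_iff)

lemma x_notin: "x \<notin> Y" "x \<notin> Z"
  using adj(5)[of x] loopless by auto

text \<open>The mirror symmetry of the path; it halves the case analysis for the upper
  bound.\<close>

lemma reverse: "lozin_graph F V x z b a y Z Y"
  using fin x dist new YV ZV loopless nbhd_a nbhd_b nbhd_y nbhd_z nbhd_x
  by unfold_locales auto

lemma ind_hom_path:
  assumes W: "W \<subseteq> V - {x}"
  shows "ind_hom TYPE('k::field) F (W \<union> {y, a, b, z}) n \<longleftrightarrow>
    (\<exists>m. n = Suc m \<and> ind_hom TYPE('k) F (insert x W) m)"
proof -
  have finW: "finite W" using W fin by (auto intro: finite_subset)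
  have ne: "x \<notin> {y, a, b, z}" "W \<inter> {x, y, a, b, z} = {}" "Z \<inter> {x, y, a, b, z} = {}" "Y \<inter> {x, y, a, b, z} = {}"
    using x new W YV ZV x_notin by auto
  \<comment> \<open>Faces with \<open>x\<close> and \<open>a\<close> exclude \<open>b\<close>, so
    \<open>z\<close> can be toggled; faces with \<open>x\<close> but not \<open>a\<close> allow
    toggling \<open>y\<close>.\<close>
  have "ind_hom TYPE('k) F (W \<union> {x, y, a, b, z}) n \<longleftrightarrow> ind_hom TYPE('k) F (W \<union> {x, y, a, b, z} - {x}) n"
    by (rule ind_hom_remove[where B = "{a}" and ?w1.0 = z and ?w2.0 = y])
      (use finW loopless ne dist in \<open>auto simp: adj\<close>)
  also have "W \<union> {x, y, a, b, z} - {x} = W \<union> {y, a, b, z}" using ne by auto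
  finally have 1: "ind_hom TYPE('k) F (W \<union> {x, y, a, b, z}) n \<longleftrightarrow> ind_hom TYPE('k) F (W \<union> {y, a, b, z}) n" .
  \<comment> \<open>Faces with \<open>y\<close> that meet \<open>Z\<close> exclude \<open>a\<close>
    and \<open>z\<close>, so \<open>b\<close> can be toggled; those that avoid \<open>Z\<close>
    allow toggling \<open>x\<close>.\<close>
  have "ind_hom TYPE('k) F (W \<union> {x, y, a, b, z}) n \<longleftrightarrow> ind_hom TYPE('k) F (W \<union> {x, y, a, b, z} - {y}) n"
  proof (rule ind_hom_remove[where B = Z and ?w1.0 = b and ?w2.0 = x])
    show "{y, u} \<in> F \<or> (\<forall>t\<in>Z. {t, u} \<in> F)" if "{b, u} \<in> F" for u
      using that adj(4) by (auto simp: adj insert_commute)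
  qed (use finW loopless ne dist in \<open>auto simp: adj\<close>)
  also have "W \<union> {x, y, a, b, z} - {y} = W \<union> {x, a, b, z}" using ne dist by auto
  \<comment> \<open>With \<open>y\<close> gone, the only neighbour of \<open>a\<close> is
    \<open>b\<close>, which is also a neighbour of \<open>z\<close>.\<close>
  also have "ind_hom TYPE('k) F (W \<union> {x, a, b, z}) n \<longleftrightarrow> ind_hom TYPE('k) F (W \<union> {x, a, b, z} - {z}) n"
    by (rule ind_hom_remove[where B = "{}" and ?w1.0 = a and ?w2.0 = a])
      (use finW loopless ne dist in \<open>auto simp: adj\<close>)
  also have "W \<union> {x, a, b, z} - {z} = W \<union> {x, a, b}" using ne dist by auto
  \<comment> \<open>The remaining edge \<open>ab\<close> is a separate component; it accounts for
    the suspension.\<close>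
  also have "ind_hom TYPE('k) F (W \<union> {x, a, b}) n \<longleftrightarrow>
      (\<exists>m. n = Suc m \<and> ind_hom TYPE('k) F (W \<union> {x, a, b} - {b} - nbhd F b) m)"
    by (rule ind_hom_leaf[of _ a]) (use finW ne dist in \<open>auto simp: adj\<close>)
  also have "W \<union> {x, a, b} - {b} - nbhd F b = insert x W"
    using ne dist by (auto simp: nbhd_b)
  finally show ?thesis using 1 by simp
qed

text \<open>Away from \<open>Z\<close> and from the path, \<open>x\<close> and \<open>y\<close> both
  have neighbourhood \<open>Y\<close>, so they are twins.\<close>

lemma ind_hom_end_vertex:
  assumes W: "W \<subseteq> V - {x} - Z"
  shows "ind_hom TYPE('k::field) F (insert y W) n \<longleftrightarrow> ind_hom TYPE('k) F (insert x W) n"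
proof (rule ind_hom_twins)
  show "finite W" using W fin by (auto intro: finite_subset)
  show "{y, u} \<in> F \<longleftrightarrow> {x, u} \<in> F" if "u \<in> W" for u
    using that W new by (auto simp: adj)
  show "{y, x} \<notin> F" using x new x_notin by (auto simp: adj)
qed (use W x new loopless in auto)

text \<open>Without \<open>a\<close>, the vertex \<open>b\<close> is isolated or a leaf at
  \<open>z\<close>. Passing to the link of \<open>z\<close> costs one degree and removes
  \<open>Z\<close>, after which \<open>x\<close> can stand in for \<open>y\<close>.\<close>

lemma ind_hom_without_a:
  assumes T: "T \<subseteq> V - {x} \<union> {y, b, z}" and "b \<in> T" and hom: "ind_hom TYPE('k::field) F T n"
  shows "\<exists>m. n = Suc m \<and> (\<exists>S\<subseteq>V. ind_hom TYPE('k) F S m)"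
proof -
  have finT: "finite T" using T fin by (auto intro: finite_subset)
  have "z \<in> T"
  proof (rule ccontr)
    assume "z \<notin> T"
    then have "\<not> ind_hom TYPE('k) F T n"
      using T new dist finT \<open>b \<in> T\<close> by (intro ind_hom_cone[of _ b]) (auto simp: adj)
    with hom show False by blast
  qed
  have "\<exists>m. n = Suc m \<and> ind_hom TYPE('k) F (T - {z} - nbhd F z) m"
    using hom T new dist finT \<open>b \<in> T\<close> \<open>z \<in> T\<close>
    by (subst (asm) ind_hom_leaf[of _ b z]) (auto simp: adj)
  then obtain m where m: "n = Suc m" "ind_hom TYPE('k) F (T - {z} - nbhd F z) m" by blast
  define W where "W = T - {z} - nbhd F z - {y}"
  have W: "W \<subseteq> V - {x} - Z" using T by (auto simp: W_def nbhd_z)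
  have "T - {z} - nbhd F z = (if y \<in> T then insert y W else W)"
    using dist new ZV by (auto simp: W_def nbhd_z)
  with m(2) ind_hom_end_vertex[OF W, where 'k = 'k]
  have "ind_hom TYPE('k) F (if y \<in> T then insert x W else W) m" by (auto split: if_splits)
  moreover have "(if y \<in> T then insert x W else W) \<subseteq> V" using W x by auto
  ultimately show ?thesis using m(1) by blast
qed

text \<open>Here \<open>a\<close> is a leaf at \<open>b\<close>, and the link of \<open>b\<close>
  loses both \<open>a\<close> and \<open>z\<close>.\<close>

lemma ind_hom_without_y:
  assumes T: "T \<subseteq> V - {x} \<union> {a, b, z}" and "a \<in> T" "b \<in> T" and hom: "ind_hom TYPE('k::field) F T n"
  shows "\<exists>m. n = Suc m \<and> (\<exists>S\<subseteq>V. ind_hom TYPE('k) F S m)"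
proof -
  have finT: "finite T" using T fin by (auto intro: finite_subset)
  have "\<exists>m. n = Suc m \<and> ind_hom TYPE('k) F (T - {b} - nbhd F b) m"
    using hom T new dist finT \<open>a \<in> T\<close> \<open>b \<in> T\<close>
    by (subst (asm) ind_hom_leaf[of _ a b]) (auto simp: adj)
  moreover have "T - {b} - nbhd F b \<subseteq> V" using T by (auto simp: nbhd_b)
  ultimately show ?thesis by blast
qed

text \<open>Deleting an end vertex keeps the degree and linking lowers it by one; only one link is
  affordable. After linking \<open>y\<close>, the vertex \<open>z\<close> is therefore traded for
  its twin \<open>x\<close>.\<close>

lemma ind_hom_without_ab:
  assumes T: "T \<subseteq> V - {x} \<union> {y, z}" and hom: "ind_hom TYPE('k::field) F T n"
  shows "\<exists>S\<subseteq>V. \<exists>m. n \<le> Suc m \<and> ind_hom TYPE('k) F S m"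
proof -
  have finT: "finite T" using T fin by (auto intro: finite_subset)
  \<comment> \<open>Once \<open>y\<close> is absent, a link at \<open>z\<close> is still
    affordable.\<close>
  have no_y: ?thesis if R: "R \<subseteq> V - {x} \<union> {z}" and "ind_hom TYPE('k) F R n" for R
  proof (cases "z \<in> R")
    case True
    have "finite R" using R fin by (auto intro: finite_subset)
    have sub: "R - {z} \<subseteq> V" "R - {z} - nbhd F z \<subseteq> V" using R by auto
    from ind_hom_delete_or_link[OF \<open>finite R\<close> True that(2)] show ?thesis
    proof
      assume "ind_hom TYPE('k) F (R - {z}) n"
      then show ?thesis using sub(1) le_Suc_eq by blast
    qed (use sub(2) in blast)
  next
    case False
    with that show ?thesis by (intro exI[of _ R] conjI exI[of _ n]) auto
  qed
  show ?thesis
  proof (cases "y \<in> T")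
    case True
    have "?thesis" if m: "n = Suc m" "ind_hom TYPE('k) F (T - {y} - nbhd F y) m" for m
    proof (cases "z \<in> T")
      case True
      interpret rev: lozin_graph F V x z b a y Z Y by (rule reverse)
      define W where "W = T - {y} - nbhd F y - {z}"
      have W: "W \<subseteq> V - {x} - Y" using T by (auto simp: W_def nbhd_y)
      have "T - {y} - nbhd F y = insert z W"
        using dist new YV True by (auto simp: W_def nbhd_y)
      with m(2) rev.ind_hom_end_vertex[OF W, where 'k = 'k]
      have "ind_hom TYPE('k) F (insert x W) m" by simp
      moreover have "insert x W \<subseteq> V" using W x by auto
      ultimately show ?thesis using m(1) by blast
    next
      case False
      then have "T - {y} - nbhd F y \<subseteq> V" using T by auto
      then show ?thesis using m by blast
    qed
    moreover have ?thesis if "ind_hom TYPE('k) F (T - {y}) n"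
      by (rule no_y[OF _ that]) (use T in auto)
    ultimately show ?thesis using ind_hom_delete_or_link[OF finT True hom] by blast
  next
    case False
    show ?thesis by (rule no_y[OF _ hom]) (use T False in auto)
  qed
qed

lemma ind_hom_upper:
  assumes T: "T \<subseteq> V - {x} \<union> {y, a, b, z}" and hom: "ind_hom TYPE('k::field) F T n"
  shows "\<exists>S\<subseteq>V. \<exists>m. n \<le> Suc m \<and> ind_hom TYPE('k) F S m"
proof -
  interpret rev: lozin_graph F V x z b a y Z Y by (rule reverse)
  \<comment> \<open>The third and fifth cases mirror the second and fourth.\<close>
  consider "{y, a, b, z} \<subseteq> T" | "a \<in> T" "b \<in> T" "y \<notin> T" | "a \<in> T" "b \<in> T" "z \<notin> T"
    | "a \<notin> T" "b \<in> T" | "a \<in> T" "b \<notin> T" | "a \<notin> T" "b \<notin> T" by blast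
  then show ?thesis
  proof cases
    case 1
    define W where "W = T \<inter> (V - {x})"
    have "T = W \<union> {y, a, b, z}" "W \<subseteq> V - {x}" using 1 T by (auto simp: W_def)
    with hom ind_hom_path[of W, where 'k = 'k] obtain m where "n = Suc m" "ind_hom TYPE('k) F (insert x W) m"
      by auto
    moreover have "insert x W \<subseteq> V" using x by (auto simp: W_def)
    ultimately show ?thesis by blast
  next
    case 2
    then have "T \<subseteq> V - {x} \<union> {a, b, z}" using T by auto
    from ind_hom_without_y[OF this 2(1,2) hom] show ?thesis by blast
  next
    case 3
    then have "T \<subseteq> V - {x} \<union> {b, a, y}" using T by auto
    from rev.ind_hom_without_y[OF this 3(2,1) hom] show ?thesis by blast
  next
    case 4
    then have "T \<subseteq> V - {x} \<union> {y, b, z}" using T by auto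
    from ind_hom_without_a[OF this 4(2) hom] show ?thesis by blast
  next
    case 5
    then have "T \<subseteq> V - {x} \<union> {z, a, y}" using T by auto
    from rev.ind_hom_without_a[OF this 5(1) hom] show ?thesis by blast
  next
    case 6
    then have "T \<subseteq> V - {x} \<union> {y, z}" using T by auto
    from ind_hom_without_ab[OF this hom] show ?thesis .
  qed
qed

text \<open>If \<open>x\<close> lies in \<open>S\<close>, the whole path replaces it. Otherwise
  adding the edge \<open>ab\<close> alone suspends the complex, as neither end has a neighbour in
  \<open>S\<close>.\<close>

lemma ind_hom_lower:
  assumes S: "S \<subseteq> V" and hom: "ind_hom TYPE('k::field) F S m"
  shows "\<exists>T \<subseteq> V - {x} \<union> {y, a, b, z}. ind_hom TYPE('k) F T (Suc m)"
proof (cases "x \<in> S")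
  case True
  then have "insert x (S - {x}) = S" by auto
  moreover have "S - {x} \<subseteq> V - {x}" using S by auto
  ultimately have "ind_hom TYPE('k) F (S - {x} \<union> {y, a, b, z}) (Suc m)"
    using ind_hom_path[of "S - {x}", where 'k = 'k] hom by simp
  moreover have "S - {x} \<union> {y, a, b, z} \<subseteq> V - {x} \<union> {y, a, b, z}" using S by auto
  ultimately show ?thesis by (intro exI[of _ "S - {x} \<union> {y, a, b, z}"] conjI)
next
  case False
  have "finite S" using S fin by (rule finite_subset)
  moreover have "S \<union> {a, b} - {b} - nbhd F b = S" using S new dist by (auto simp: nbhd_b)
  ultimately have "ind_hom TYPE('k) F (S \<union> {a, b}) (Suc m)"
    using hom S new dist by (subst ind_hom_leaf[of _ a b]) (auto simp: adj)
  moreover have "S \<union> {a, b} \<subseteq> V - {x} \<union> {y, a, b, z}" using S False by auto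
  ultimately show ?thesis by blast
qed

end

section \<open>Regularity as an attained maximum, and the conclusion\<close>

lemma ind_hom_le_card:
  assumes "finite V" and "S \<subseteq> V" and "ind_hom TYPE('k::field) E S n"
  shows "n \<le> card V"
proof -
  have "complex_on V (ind_complex E S)" using assms by (intro complex_on_ind)
  then obtain \<sigma> where "\<sigma> \<in> ind_complex E S" "card \<sigma> = n"
    using red_hom_nonzero_face assms(3) by blast
  then show ?thesis using assms(1,2) by (auto simp: ind_complex_def intro!: card_mono)
qed

text \<open>The empty face is a cycle that bounds nothing, which is the convention for the empty
  graph; it makes the set under \<open>Max\<close> nonempty.\<close>

lemma ind_hom_empty: "ind_hom TYPE('k::field) E {} 0"
proof -
  have K: "complex_on {} (ind_complex E {})" by (rule complex_on_ind) auto
  have "(\<lambda>\<sigma>. if \<sigma> = {} then 1 else 0 :: 'k) \<in> chains (ind_complex E {}) 0"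
    by (auto simp: chains_def ind_complex_def)
  moreover have "(0 :: 'a set \<Rightarrow> 'k) \<noteq> (\<lambda>\<sigma>. if \<sigma> = {} then 1 else 0)"
    by (auto simp: fun_eq_iff)
  ultimately show ?thesis
    by (subst red_hom_nonzero_iff[OF K]) (auto simp: bdry_empty)
qed

lemma
  assumes "finite V"
  shows reg_attained: "\<exists>S\<subseteq>V. ind_hom TYPE('k::field) E S (reg TYPE('k) V E)"
    and ind_hom_le_reg: "S \<subseteq> V \<Longrightarrow> ind_hom TYPE('k) E S n \<Longrightarrow> n \<le> reg TYPE('k) V E"
proof -
  let ?J = "{j. \<exists>S\<subseteq>V. ind_hom TYPE('k) E S j}"
  have "?J \<subseteq> {..card V}" using ind_hom_le_card[OF assms] by auto
  then have fin: "finite ?J" by (rule finite_subset) simp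
  moreover have "0 \<in> ?J" using ind_hom_empty by blast
  ultimately have "Max ?J \<in> ?J" by (intro Max_in) auto
  then show "\<exists>S\<subseteq>V. ind_hom TYPE('k) E S (reg TYPE('k) V E)" by (simp add: reg_def)
  show "n \<le> reg TYPE('k) V E" if "S \<subseteq> V" "ind_hom TYPE('k) E S n"
    unfolding reg_def using fin that by (intro Max_ge) auto
qed

theorem theorem1p2:
  fixes V :: "'a::linorder set" and E :: "'a set set" and x y a b z :: 'a
    and Y Z :: "'a set"
  assumes "simple_graph V E" and "x \<in> V"
    and "Y \<union> Z = nbhd E x" and "Y \<inter> Z = {}"
    and "distinct [y, a, b, z]" and "y \<notin> V" and "a \<notin> V" and "b \<notin> V" and "z \<notin> V"
  shows "reg TYPE('k::field) (lozin_V V x y a b z) (lozin_E E x Y Z y a b z)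
           = reg TYPE('k) V E + 1"
proof -
  define F where "F = E \<union> lozin_E E x Y Z y a b z"
  let ?L = "lozin_V V x y a b z" and ?EL = "lozin_E E x Y Z y a b z"
  have L: "?L = V - {x} \<union> {y, a, b, z}" by (simp add: lozin_V_def)
  have finV: "finite V" and EV: "\<And>u v. {u, v} \<in> E \<Longrightarrow> u \<in> V \<and> v \<in> V \<and> u \<noteq> v"
    using assms(1) unfolding simple_graph_def by (blast, metis doubleton_eq_iff)
  have nx: "{x, v} \<in> E \<longleftrightarrow> v \<in> Y \<or> v \<in> Z" for v
    using assms(3) by (auto simp: nbhd_def set_eq_iff)
  have YZ: "Y \<subseteq> V" "Z \<subseteq> V" "x \<notin> Y" "x \<notin> Z" using nx EV by blast+
  have F_iff: "{u, v} \<in> F \<longleftrightarrow> {u, v} \<in> E \<or> {u, v} \<in> {{y, a}, {a, b}, {b, z}}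
      \<or> u = y \<and> v \<in> Y \<or> v = y \<and> u \<in> Y \<or> u = z \<and> v \<in> Z \<or> v = z \<and> u \<in> Z" for u v
    by (auto simp: F_def lozin_E_def doubleton_eq_iff)
  have loop: "{u} \<notin> F" for u
    using F_iff[of u u] EV[of u u] YZ assms(5-9) by (auto simp: doubleton_eq_iff)
  interpret lozin_graph F V x y a b z Y Z
  proof
    show "nbhd F a = {y, b}" "nbhd F b = {a, z}" "nbhd F y = insert a Y" "nbhd F z = insert b Z"
      "nbhd F x = Y \<union> Z"
      using EV YZ assms(2,5-9) nx by (auto simp: nbhd_def F_iff doubleton_eq_iff)
  qed (use assms finV YZ loop in auto)
  \<comment> \<open>Every edge of \<open>F\<close> that is not in \<open>E\<close> contains one of
    the four new vertices.\<close>
  have G: "ind_complex E S = ind_complex F S" if "S \<subseteq> V" for S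
    by (rule ind_complex_cong) (use that assms(6-9) in \<open>auto simp: F_iff doubleton_eq_iff\<close>)
  \<comment> \<open>The transform drops only edges through \<open>x\<close>, which is not in
    \<open>T\<close>.\<close>
  have H: "ind_complex ?EL T = ind_complex F T" if "T \<subseteq> ?L" for T
  proof (rule ind_complex_cong)
    have "x \<notin> T" using that assms(2,6-9) unfolding L by blast
    fix u v assume "u \<in> T" "v \<in> T"
    with \<open>x \<notin> T\<close> have "x \<notin> {u, v}" by blast
    then show "{u, v} \<in> ?EL \<longleftrightarrow> {u, v} \<in> F" unfolding F_def lozin_E_def by blast
  qed
  have finL: "finite ?L" using finV by (simp add: L)
  obtain S where S: "S \<subseteq> V" "ind_hom TYPE('k) E S (reg TYPE('k) V E)"
    using reg_attained[OF finV] by blast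
  from S(2) have "ind_hom TYPE('k) F S (reg TYPE('k) V E)" by (simp add: G[OF S(1)])
  from ind_hom_lower[OF S(1) this, folded L] obtain T
    where T: "T \<subseteq> ?L" "ind_hom TYPE('k) F T (Suc (reg TYPE('k) V E))"
    by blast
  then have ge: "Suc (reg TYPE('k) V E) \<le> reg TYPE('k) ?L ?EL"
    by (intro ind_hom_le_reg[OF finL T(1)]) (simp add: H[OF T(1)])
  obtain T' where T': "T' \<subseteq> ?L" "ind_hom TYPE('k) ?EL T' (reg TYPE('k) ?L ?EL)"
    using reg_attained[OF finL] by blast
  from T'(2) have "ind_hom TYPE('k) F T' (reg TYPE('k) ?L ?EL)" by (simp add: H[OF T'(1)])
  from ind_hom_upper[OF T'(1)[unfolded L] this] obtain S' m
    where S': "S' \<subseteq> V" "reg TYPE('k) ?L ?EL \<le> Suc m" "ind_hom TYPE('k) F S' m"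
    by blast
  then have "m \<le> reg TYPE('k) V E"
    by (intro ind_hom_le_reg[OF finV S'(1)]) (simp add: G[OF S'(1)])
  with ge S'(2) show ?thesis by simp
qed

end
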